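(* For every integer $N>3$ there exists a solution to the $N$-Queens Problem which can be represented as a Queen function of width less than or equal to $3$.
   Context: For a positive integer $N$, $[1,N]$ denotes the set of integers $\{1,\dots,N\}$, and similarly for other integer segments (sets of consecutive integers). A solution to the $N$-Queens Problem is a permutation $A$ of $[1,N]$ such that $|i-j|\neq|A(i)-A(j)|$ for all $1\le i<j\le N$. A map $f:S\subseteq[1,N]\to[1,N]$ is called linear on $S$ if there exist integers $a\in[1,N]$ and $b\in[0,N]$ such that $f(i)=ai+b \pmod{N+1}$ for all $i\in S$; here "$x \pmod{N+1}$" denotes the residue of $x$ in $\{0,1,\dots,N\}$. A Queen function is a map $[1,N]\to[1,N]$ together with a partition of $[1,N]$ into segments such that, on each segment of the partition, the map is linear on the subset of even numbers of that segment and linear on the subset of odd numbers of that segment (with possibly different $a,b$). The width of the Queen function is the number of segments of the partition. *)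

theory Defs
  imports Main "HOL-Library.FuncSet" "HOL-Library.Disjoint_Sets" "HOL-Combinatorics.Permutations"
begin

definition queens_solution :: "nat \<Rightarrow> (nat \<Rightarrow> nat) \<Rightarrow> bool" where
  "queens_solution N A \<longleftrightarrow> A permutes {1..N} \<and>
     (\<forall>i j. 1 \<le> i \<longrightarrow> i < j \<longrightarrow> j \<le> N \<longrightarrow> \<bar>int i - int j\<bar> \<noteq> \<bar>int (A i) - int (A j)\<bar>)"

definition mod_linear_on :: "nat \<Rightarrow> nat set \<Rightarrow> (nat \<Rightarrow> nat) \<Rightarrow> bool" where
  "mod_linear_on N S f \<longleftrightarrow> S \<subseteq> {1..N} \<and> f \<in> S \<rightarrow> {1..N} \<and>
     (\<exists>a\<in>{1..N}. \<exists>b\<in>{0..N}. \<forall>i\<in>S. f i = (a * i + b) mod (N + 1))"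

definition segment :: "nat set \<Rightarrow> bool" where
  "segment I \<longleftrightarrow> (\<exists>l u. I = {l..u})"

text \<open>The parts of \<^const>\<open>partition_on\<close> are nonempty, so the width (the number of
  parts) counts no empty segments.\<close>

definition queen_function :: "nat \<Rightarrow> (nat \<Rightarrow> nat) \<Rightarrow> nat set set \<Rightarrow> bool" where
  "queen_function N f P \<longleftrightarrow> f \<in> {1..N} \<rightarrow> {1..N} \<and> partition_on {1..N} P \<and>
     (\<forall>I\<in>P. segment I \<and> mod_linear_on N {i\<in>I. even i} f \<and> mod_linear_on N {i\<in>I. odd i} f)"

definition queen_width :: "nat set set \<Rightarrow> nat" where
  "queen_width P = card P"

end

theory Submission imports Defs begin

text \<open>
  All boards below are filled by runs of slope 2: from one position to the next (or to
  the next one of the same parity) the value follows \<open>2 * i + b\<close> modulo \<open>N + 1\<close>. As long as a run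
  does not wrap around, slope 2 is harmless inside it, since \<open>2 * (i - j)\<close> is none of \<open>0\<close>,
  \<open>i - j\<close> and \<open>j - i\<close> when \<open>i \<noteq> j\<close>; after wrapping around, it counts as a new run.
  Two queens in different runs can meet in three ways. Equal values are excluded by residues of the value, typically because one run has even and the other odd values. A common
  diagonal with constant difference is excluded because the differences of two runs
  lie in disjoint ranges or have different parities. A common diagonal with constant sum is the
  essential obstruction: the sum in a run is \<open>3 * i\<close> plus a constant, hence it has a constant
  residue modulo 3, and the offsets are chosen so that runs have different
  residues, or their sums are otherwise kept apart.

  Write \<open>N\<close> as \<open>2 * m\<close> or \<open>2 * m + 1\<close>. The natural arrangement, the even values in increasing
  order followed by the odd ones, has sums with residue \<open>0\<close> in the first half and \<open>m - 1\<close> modulo 3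
  in the second. So it works unless \<open>m mod 3 = 1\<close>, that is, unless \<open>N mod 6\<close> is 2 or 3. In the
  remaining cases the halves are modified: for odd \<open>N\<close> each is rotated by moving its smallest
  values to its end; for even \<open>N\<close> the even half has neighbours interchanged in pairs, which
  gives separate runs on even and on odd positions.
  Interchanging all pairs needs an even number of even values, so \<open>N mod 12 = 2\<close> requires one more
  change: the value 2 is moved to the last position, and the pairs are formed from the rest.
  No arrangement uses more than three segments.
\<close>

section \<open>Queen functions of slope two and width at most three\<close>

lemma mod_linear_onI:
  assumes "S \<subseteq> {1..N}" "f ` S \<subseteq> {1..N}" "2 \<le> N" "b \<le> N"
    and "\<And>i. i \<in> S \<Longrightarrow> f i = (2 * i + b) mod (N + 1)"
  shows "mod_linear_on N S f"
  unfolding mod_linear_on_def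
proof (intro conjI)
  show "f \<in> S \<rightarrow> {1..N}" using assms(2) by auto
  have "2 \<in> {1..N}" "b \<in> {0..N}" using assms(3,4) by auto
  then show "\<exists>a\<in>{1..N}. \<exists>b\<in>{0..N}. \<forall>i\<in>S. f i = (a * i + b) mod (N + 1)"
    using assms(5) by blast
qed fact

text \<open>Removing the empty set lets one triple of segments also describe partitions of width one
  or two, with coinciding cut points.\<close>
lemma segments_partition:
  fixes k l N :: nat
  assumes "k \<le> l" "l \<le> N"
  shows "partition_on {1..N} ({{1..k}, {Suc k..l}, {Suc l..N}} - {{}})"
proof -
  define Q where "Q = {{1..k}, {Suc k..l}, {Suc l..N}}"
  have "\<Union>Q = {1..N}" using assms by (auto simp: Q_def)
  moreover have "disjnt {1..k} {Suc k..l}" "disjnt {1..k} {Suc l..N}" "disjnt {Suc k..l} {Suc l..N}"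
    using assms by (auto simp: disjnt_def)
  moreover have "disjoint {A, B, C}" if "disjnt A B" "disjnt A C" "disjnt B C" for A B C :: "nat set"
    using that by (auto simp: pairwise_def disjnt_sym)
  ultimately have "\<Union>Q = {1..N}" "disjoint Q" by (simp_all only: Q_def)
  then have "partition_on {1..N} (Q - {{}})"
    by (intro partition_onI) (auto simp: pairwise_def disjnt_def)
  then show ?thesis by (simp only: Q_def)
qed

text \<open>Each segment has one offset for even and one for odd positions, selected by
  \<open>p (even i)\<close> and its analogues. The condition that no two queens attack each other is stated
  additively on natural numbers, where it becomes linear on each pair of runs.\<close>
lemma queen_solution_from_offsets:
  fixes p q r :: "bool \<Rightarrow> nat"
  assumes "2 \<le> N" "k \<le> l" "l \<le> N"
    and range: "\<And>i. 1 \<le> i \<Longrightarrow> i \<le> N \<Longrightarrow> 1 \<le> f i \<and> f i \<le> N"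
    and safe: "\<And>i j. 1 \<le> i \<Longrightarrow> i < j \<Longrightarrow> j \<le> N \<Longrightarrow>
      f i \<noteq> f j \<and> f i + j \<noteq> f j + i \<and> f i + i \<noteq> f j + j"
    and le: "\<And>e. p e \<le> N" "\<And>e. q e \<le> N" "\<And>e. r e \<le> N"
    and p: "\<And>i. 1 \<le> i \<Longrightarrow> i \<le> k \<Longrightarrow> f i = (2 * i + p (even i)) mod (N + 1)"
    and q: "\<And>i. k < i \<Longrightarrow> i \<le> l \<Longrightarrow> f i = (2 * i + q (even i)) mod (N + 1)"
    and r: "\<And>i. l < i \<Longrightarrow> i \<le> N \<Longrightarrow> f i = (2 * i + r (even i)) mod (N + 1)"
  shows "\<exists>A P. queens_solution N A \<and> queen_function N A P \<and> queen_width P \<le> 3"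
proof -
  \<comment> \<open>A permutation of the segment has to be the identity outside it.\<close>
  define A where "A i = (if i \<in> {1..N} then f i else i)" for i
  define Q where "Q = {{1..k}, {Suc k..l}, {Suc l..N}}"
  have A_eq: "A i = f i" if "1 \<le> i" "i \<le> N" for i using that by (simp add: A_def)
  have A_range: "A i \<in> {1..N}" if "i \<in> {1..N}" for i using that range by (simp add: A_def)
  have "inj_on A {1..N}"
  proof (rule linorder_inj_onI')
    fix i j assume "i \<in> {1..N}" "j \<in> {1..N}" "i < j"
    then show "A i \<noteq> A j" using safe[of i j] by (simp add: A_eq)
  qed
  moreover have "A ` {1..N} \<subseteq> {1..N}" using A_range by blast
  ultimately have "bij_betw A {1..N} {1..N}"
    by (simp add: bij_betw_def endo_inj_surj)
  then have "A permutes {1..N}"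
    by (rule bij_imp_permutes) (auto simp: A_def)
  moreover have "\<bar>int i - int j\<bar> \<noteq> \<bar>int (A i) - int (A j)\<bar>" if "1 \<le> i" "i < j" "j \<le> N" for i j
    using safe[OF that] that by (simp add: A_eq abs_if)
  ultimately have sol: "queens_solution N A" by (simp add: queens_solution_def)
  have lin: "mod_linear_on N {i\<in>I. even i = e} A" if "I \<in> Q" for I e
  proof -
    have "I \<subseteq> {1..N}" using that \<open>k \<le> l\<close> \<open>l \<le> N\<close> by (auto simp: Q_def)
    moreover obtain b where "b \<le> N" "\<And>i. i \<in> I \<Longrightarrow> even i = e \<Longrightarrow> f i = (2 * i + b) mod (N + 1)"
    proof -
      consider "I = {1..k}" | "I = {Suc k..l}" | "I = {Suc l..N}" using \<open>I \<in> Q\<close> by (auto simp: Q_def)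
      then show thesis
      proof cases
        case 1 then show thesis using that[of "p e"] le p by auto
      next
        case 2 then show thesis using that[of "q e"] le q by auto
      next
        case 3 then show thesis using that[of "r e"] le r by auto
      qed
    qed
    moreover from calculation(1) have "A i = f i" if "i \<in> I" for i
      using that A_eq by (auto simp: subset_iff)
    moreover from calculation(1) have "A ` {i\<in>I. even i = e} \<subseteq> {1..N}"
      using A_range by blast
    ultimately show ?thesis
      using \<open>2 \<le> N\<close> by (intro mod_linear_onI[of _ _ _ b]) auto
  qed
  have "segment I" if "I \<in> Q" for I using that by (auto simp: Q_def segment_def)
  then have "queen_function N A (Q - {{}})"
    using segments_partition[OF \<open>k \<le> l\<close> \<open>l \<le> N\<close>] A_range lin[of _ True] lin[of _ False]
    by (auto simp: queen_function_def Q_def)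
  moreover have "queen_width (Q - {{}}) \<le> 3"
  proof -
    have "card (Q - {{}}) \<le> card Q" by (rule card_mono) (auto simp: Q_def)
    also have "\<dots> \<le> 3" unfolding Q_def by (auto simp: card_insert_if)
    finally show ?thesis unfolding queen_width_def .
  qed
  ultimately show ?thesis using sol by (intro exI conjI)
qed

section \<open>Residues of runs\<close>

text \<open>The witness \<open>c\<close> counts how often the run \<open>2 * i + b\<close> has wrapped around.\<close>
lemma eq_modI:
  fixes x y c N :: nat
  assumes "x = y + c * (N + 1)" "y \<le> N"
  shows "y = x mod (N + 1)"
proof -
  have "x mod (N + 1) = y mod (N + 1)" unfolding assms(1) by (rule mod_mult_self1)
  also have "\<dots> = y" using assms(2) by (intro mod_less) simp
  finally show ?thesis by (rule sym)
qed

lemma residueI: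
  fixes x q r k :: nat
  assumes "x = k * q + r" "r < k"
  shows "x mod k = r"
  using assms by simp

text \<open>The sum has the same parity as the integer difference, and unlike the latter needs no
  truncated subtraction.\<close>
lemma parity_of_diagonals:
  fixes i j u v :: nat
  assumes "u + j = v + i"
  shows "(u + i) mod 2 = (v + j) mod 2"
proof -
  have "even (u + j) \<longleftrightarrow> even (v + i)" using assms by (simp only:)
  then have "even (u + i) \<longleftrightarrow> even (v + j)" by auto
  then show ?thesis by (simp only: mod_2_eq_odd)
qed

section \<open>The four families of boards\<close>

text \<open>The arrangement is \<open>2, 4, ..., 2 * m, 1, 3, ...\<close>. Queens at \<open>i \<le> m < j\<close> with equal sums would
  give \<open>3 * (j - i) = 2 * m + 1\<close>, which needs \<open>m mod 3 = 1\<close>.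
  For \<open>N = 2 * m\<close> the wrap modulo \<open>N + 1\<close> turns the even run into the odd one by itself; for
  \<open>N = 2 * m + 1\<close> the second half needs offset 1.

  Here and below \<open>rv\<close>, \<open>rd\<close> and \<open>rs\<close> are residues of the value, the difference (via the
  parity of the sum) and the sum. Named as functions of the position, they leave the comparison of
  any two runs to linear arithmetic.\<close>
lemma queens_even_then_odd:
  fixes m N :: nat
  assumes "2 \<le> m" "m mod 3 \<noteq> 1" "N = 2 * m \<or> N = 2 * m + 1"
  shows "\<exists>A P. queens_solution N A \<and> queen_function N A P \<and> queen_width P \<le> 3"
proof -
  define f where "f i = (if i \<le> m then 2 * i else 2 * i - (2 * m + 1))" for i
  define rv where "rv i = f i mod 2" for i
  define rs where "rs i = (f i + i) mod 3" for i
  have val: "i \<le> m \<and> f i = 2 * i \<and> rv i = 0 \<and> rs i = 0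
      \<or> m < i \<and> f i + 2 * m + 1 = 2 * i \<and> rv i = 1 \<and> rs i > 0" for i
  proof (cases "i \<le> m")
    case True
    then have "f i = 2 * i" by (simp add: f_def)
    with True show ?thesis by (simp add: rv_def rs_def)
  next
    case False
    then have "f i + 2 * m + 1 = 2 * i" by (simp add: f_def)
    moreover from this have "rv i = 1" unfolding rv_def by presburger
    \<comment> \<open>Generalizing \<open>f i\<close> to \<open>u\<close> gives a purely arithmetical statement.\<close>
    moreover have "rs i \<noteq> 0" if "u = f i" "u + 2 * m + 1 = 2 * i" for u
      unfolding rs_def that(1)[symmetric] using that(2) assms(2) by presburger
    ultimately show ?thesis using False by simp
  qed
  let ?p = "\<lambda>_::bool. 0::nat" and ?q = "\<lambda>_::bool. N - 2 * m"
  show ?thesis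
  proof (rule queen_solution_from_offsets)
    show "2 \<le> N" "m \<le> N" "N \<le> N" using assms by auto
    show range: "1 \<le> f i \<and> f i \<le> N" if "1 \<le> i" "i \<le> N" for i
      using val[of i] that assms(3) by (elim disjE conjE; linarith)
    show "f i \<noteq> f j \<and> f i + j \<noteq> f j + i \<and> f i + i \<noteq> f j + j"
      if "1 \<le> i" "i < j" "j \<le> N" for i j
    proof (intro conjI notI)
      assume eq: "f i = f j"
      then have "rv i = rv j" by (simp add: rv_def)
      then show False
        using val[of i] val[of j]
          eq that assms(3) by (elim disjE conjE; linarith)
    next
      assume eq: "f i + j = f j + i"
      from eq show False
        using val[of i] val[of j]
          eq that assms(3) by (elim disjE conjE; linarith)
    next
      assume eq: "f i + i = f j + j"
      then have "rs i = rs j" by (simp add: rs_def)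
      then show False
        using val[of i] val[of j]
          eq that assms(3) by (elim disjE conjE; linarith)
    qed
    show "?p e \<le> N" "?q e \<le> N" "?q e \<le> N" for e by auto
    show "f i = (2 * i + ?p (even i)) mod (N + 1)" if "1 \<le> i" "i \<le> m" for i
      using that assms(3) by (intro eq_modI[where c = 0]) (auto simp: f_def)
    show "f i = (2 * i + ?q (even i)) mod (N + 1)" if "m < i" "i \<le> N" for i
      using that assms(3) by (intro eq_modI[where c = 1]) (auto simp: f_def)
    show "f i = (2 * i + ?q (even i)) mod (N + 1)" if "N < i" "i \<le> N" for i
      using that by simp
  qed
qed

text \<open>The arrangement is \<open>4, 6, ..., 2 * m\<close>, then \<open>2\<close>, then \<open>5, 7, ..., 2 * m + 1, 1, 3\<close>. The sums in
  the two long runs now have residues 2 and 1 modulo 3. The pieces \<open>2\<close> and \<open>1, 3\<close> both have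
  residue 0, but their sums are \<open>m + 2\<close> and at least \<open>2 * m + 1\<close>. As \<open>N + 1\<close> is even, the last run
  steps from \<open>N\<close> to 1 without passing 0, so \<open>1, 3\<close> belongs to the same segment as the run before.\<close>
lemma queens_odd_multiple_of_three:
  fixes m N :: nat
  assumes "4 \<le> m" "m mod 3 = 1" "N = 2 * m + 1"
  shows "\<exists>A P. queens_solution N A \<and> queen_function N A P \<and> queen_width P \<le> 3"
proof -
  define f where "f i = (if i < m then 2 * i + 2 else if i = m then 2
    else if i < 2 * m then 2 * i + 3 - 2 * m else 2 * i + 1 - 4 * m)" for i
  define rv where "rv i = f i mod 2" for i
  define rs where "rs i = (f i + i) mod 3" for i
  define t where "t = m div 3"
  have t: "m = 3 * t + 1" using mult_div_mod_eq[of 3 m] assms(2) by (simp add: t_def)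
  have val: "i < m \<and> f i = 2 * i + 2 \<and> rv i = 0 \<and> rs i = 2
      \<or> i = m \<and> f i = 2 \<and> rv i = 0 \<and> rs i = 0
      \<or> m < i \<and> i < 2 * m \<and> f i + 2 * m = 2 * i + 3 \<and> rv i = 1 \<and> rs i = 1
      \<or> 2 * m \<le> i \<and> f i + 4 * m = 2 * i + 1 \<and> rv i = 1 \<and> rs i = 0" for i
  proof -
    consider "i < m" | "i = m" | "m < i" "i < 2 * m" | "2 * m \<le> i" by linarith
    then show ?thesis
    proof cases
      case 1
      then have "f i = 2 * (i + 1) + 0" "f i + i = 3 * i + 2" by (simp_all add: f_def)
      then have "rv i = 0" "rs i = 2" unfolding rv_def rs_def by - (erule residueI, simp)+
      then show ?thesis using 1 by (simp add: f_def)
    next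
      case 2
      then have "f i + i = 3 * (t + 1)" using assms(1) t by (simp add: f_def)
      then show ?thesis using 2 assms(1) by (simp add: rv_def rs_def f_def)
    next
      case 3
      define k where "k = i - m"
      have "i = m + k" using 3 by (simp add: k_def)
      then have "f i = 2 * (k + 1) + 1" "f i + i = 3 * (k + t + 1) + 1"
        using t 3 by (simp_all add: f_def)
      then have "rv i = 1" "rs i = 1" unfolding rv_def rs_def by - (erule residueI, simp)+
      then show ?thesis using 3 by (simp add: f_def)
    next
      case 4
      define k where "k = i - 2 * m"
      have "i = 2 * m + k" using 4 by (simp add: k_def)
      then have "f i = 2 * k + 1" "f i + i = 3 * (k + 2 * t + 1) + 0"
        using t 4 assms(1) by (simp_all add: f_def)
      then have "rv i = 1" "rs i = 0" unfolding rv_def rs_def by - (erule residueI, simp)+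
      then show ?thesis using 4 assms(1) by (simp add: f_def)
    qed
  qed
  \<comment> \<open>The middle segment is the single position \<open>m\<close>, where offset 4 produces \<open>2 * m + 4 = 2 + (N + 1)\<close>.\<close>
  let ?p = "\<lambda>_::bool. 2::nat" and ?q = "\<lambda>_::bool. 4::nat" and ?r = "\<lambda>_::bool. 5::nat"
  show ?thesis
  proof (rule queen_solution_from_offsets)
    show "2 \<le> N" "m - 1 \<le> m" "m \<le> N" using assms by auto
    show range: "1 \<le> f i \<and> f i \<le> N" if "1 \<le> i" "i \<le> N" for i
      using val[of i] that assms(1,3) by (elim disjE conjE; linarith)
    show "f i \<noteq> f j \<and> f i + j \<noteq> f j + i \<and> f i + i \<noteq> f j + j"
      if "1 \<le> i" "i < j" "j \<le> N" for i j
    proof (intro conjI notI)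
      assume eq: "f i = f j"
      then have "rv i = rv j" by (simp add: rv_def)
      then show False
        using val[of i] val[of j]
          eq that assms(1,3) by (elim disjE conjE; linarith)
    next
      assume eq: "f i + j = f j + i"
      from eq show False
        using val[of i] val[of j]
          eq that assms(1,3) by (elim disjE conjE; linarith)
    next
      assume eq: "f i + i = f j + j"
      then have "rs i = rs j" by (simp add: rs_def)
      then show False
        using val[of i] val[of j]
          eq that assms(1,3) by (elim disjE conjE; linarith)
    qed
    show "?p e \<le> N" "?q e \<le> N" "?r e \<le> N" for e using assms by auto
    show "f i = (2 * i + ?p (even i)) mod (N + 1)" if "1 \<le> i" "i \<le> m - 1" for i
      using that assms by (intro eq_modI[where c = 0]) (auto simp: f_def)
    show "f i = (2 * i + ?q (even i)) mod (N + 1)" if "m - 1 < i" "i \<le> m" for i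
      using that assms by (intro eq_modI[where c = 1]) (auto simp: f_def)
    show "f i = (2 * i + ?r (even i)) mod (N + 1)" if "m < i" "i \<le> N" for i
      using that assms
      by (intro eq_modI[where c = "if i < 2 * m then 1 else 2"]) (auto simp: f_def)
  qed
qed

text \<open>The arrangement is \<open>4, 2, 8, 6, ..., 2 * m, 2 * m - 2, 1, 3, ..., 2 * m - 1\<close>. The interchanged pairs
  split the first half into two runs whose sums have residues 1 and 2 modulo 3, leaving residue 0
  for the odd values. These two runs are further told apart by their values modulo 4 and by the
  parities of their differences.\<close>
lemma queens_eight_mod_twelve:
  fixes m N :: nat
  assumes "m mod 6 = 4" "N = 2 * m"
  shows "\<exists>A P. queens_solution N A \<and> queen_function N A P \<and> queen_width P \<le> 3"
proof -
  define f where "f i = (if i \<le> m then if even i then 2 * i - 2 else 2 * i + 2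
    else 2 * i - (2 * m + 1))" for i
  define rv where "rv i = f i mod 4" for i
  define rd where "rd i = (f i + i) mod 2" for i
  define rs where "rs i = (f i + i) mod 3" for i
  define t where "t = m div 6"
  have t: "m = 6 * t + 4" using mult_div_mod_eq[of 6 m] assms(1) by (simp add: t_def)
  have val: "i \<le> m \<and> 2 \<le> i \<and> f i + 2 = 2 * i \<and> rv i = 2 \<and> rd i = 0 \<and> rs i = 1
      \<or> i + 1 \<le> m \<and> f i = 2 * i + 2 \<and> rv i = 0 \<and> rd i = 1 \<and> rs i = 2
      \<or> m < i \<and> f i + 2 * m + 1 = 2 * i \<and> (rv i = 1 \<or> rv i = 3) \<and> rs i = 0" if "1 \<le> i" for i
  proof -
    consider k where "i = 2 * k + 2" "i \<le> m" | k where "i = 2 * k + 1" "i \<le> m" | k where "i = m + 1 + k"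
    proof -
      consider "i = 2 * (i div 2 - 1) + 2" "i \<le> m" | "i = 2 * (i div 2) + 1" "i \<le> m" | "i = m + 1 + (i - (m + 1))"
        using \<open>1 \<le> i\<close> by linarith
      then show thesis using that by cases blast+
    qed
    then show ?thesis
    proof cases
      case (1 k)
      then have "f i = 4 * k + 2" "f i + i = 2 * (3 * k + 2) + 0" "f i + i = 3 * (2 * k + 1) + 1"
        by (auto simp: f_def)
      then have "rv i = 2" "rd i = 0" "rs i = 1" unfolding rv_def rs_def rd_def by - (erule residueI, simp)+
      then show ?thesis using 1 by (simp add: f_def)
    next
      case (2 k)
      then have "f i = 4 * (k + 1) + 0" "f i + i = 2 * (3 * k + 2) + 1" "f i + i = 3 * (2 * k + 1) + 2"
        by (auto simp: f_def)
      then have "rv i = 0" "rd i = 1" "rs i = 2" unfolding rv_def rs_def rd_def by - (erule residueI, simp)+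
      \<comment> \<open>\<open>m\<close> is even, so the pair that begins at an odd position is complete.\<close>
      moreover have "i + 1 \<le> m" using 2 t by presburger
      ultimately show ?thesis using 2 by (simp add: f_def)
    next
      case (3 k)
      then have "f i = 2 * k + 1" "f i + i = 3 * (k + 2 * t + 2) + 0" using t by (auto simp: f_def)
      then have "rs i = 0" unfolding rs_def by - (erule residueI, simp)
      moreover have "rv i = 1 \<or> rv i = 3" unfolding rv_def \<open>f i = 2 * k + 1\<close> by presburger
      ultimately show ?thesis using 3 by (simp add: f_def)
    qed
  qed
  \<comment> \<open>The offset \<open>N - 1\<close> stands for -2.\<close>
  let ?p = "\<lambda>e. if e then N - 1 else 2" and ?q = "\<lambda>_::bool. 0::nat"
  show ?thesis
  proof (rule queen_solution_from_offsets)
    show "2 \<le> N" "m \<le> N" "N \<le> N" using t assms by auto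
    show range: "1 \<le> f i \<and> f i \<le> N" if "1 \<le> i" "i \<le> N" for i
      using val[OF that(1)] that assms(2) by (elim disjE conjE; linarith)
    show "f i \<noteq> f j \<and> f i + j \<noteq> f j + i \<and> f i + i \<noteq> f j + j"
      if "1 \<le> i" "i < j" "j \<le> N" for i j
    proof (intro conjI notI)
      assume eq: "f i = f j"
      then have "rv i = rv j" by (simp add: rv_def)
      then show False
        using val[of i, OF that(1)]
          val[of j, OF order.trans[OF that(1) less_imp_le[OF that(2)]]]
          eq that assms(2) by (elim disjE conjE; linarith)
    next
      assume eq: "f i + j = f j + i"
      then have "rd i = rd j" unfolding rd_def by (rule parity_of_diagonals)
      then show False
        using val[of i, OF that(1)]
          val[of j, OF order.trans[OF that(1) less_imp_le[OF that(2)]]]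
          eq that assms(2) by (elim disjE conjE; linarith)
    next
      assume eq: "f i + i = f j + j"
      then have "rs i = rs j" by (simp add: rs_def)
      then show False
        using val[of i, OF that(1)]
          val[of j, OF order.trans[OF that(1) less_imp_le[OF that(2)]]]
          eq that assms(2) by (elim disjE conjE; linarith)
    qed
    show "?p e \<le> N" "?q e \<le> N" "?q e \<le> N" for e using t assms by auto
    show "f i = (2 * i + ?p (even i)) mod (N + 1)" if "1 \<le> i" "i \<le> m" for i
      using that range[of i] assms
      by (intro eq_modI[where c = "if even i then 1 else 0"]) (auto simp: f_def)
    show "f i = (2 * i + ?q (even i)) mod (N + 1)" if "m < i" "i \<le> N" for i
      using that assms by (intro eq_modI[where c = 1]) (auto simp: f_def)
    show "f i = (2 * i + ?q (even i)) mod (N + 1)" if "N < i" "i \<le> N" for i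
      using that by simp
  qed
qed

text \<open>The arrangement is \<open>6, 4, 10, 8, ..., 2 * m, 2 * m - 2, 1, 3, ..., 2 * m - 1, 2\<close>. Modulo 3 the queen
  in the last position cannot be told from the run on odd positions by its sum, \<open>N + 2\<close> against
  \<open>3 * i + 4\<close>; modulo 6 these are 4 and 1.\<close>
lemma queens_two_mod_twelve:
  fixes m N :: nat
  assumes "2 \<le> m" "m mod 6 = 1" "N = 2 * m"
  shows "\<exists>A P. queens_solution N A \<and> queen_function N A P \<and> queen_width P \<le> 3"
proof -
  define f where "f i = (if i < m then if even i then 2 * i else 2 * i + 4
    else if i < 2 * m then 2 * i + 1 - 2 * m else 2)" for i
  define rv where "rv i = f i mod 4" for i
  define rd where "rd i = (f i + i) mod 2" for i
  define rs where "rs i = (f i + i) mod 6" for i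
  define t where "t = m div 6"
  have t: "m = 6 * t + 1" using mult_div_mod_eq[of 6 m] assms(2) by (simp add: t_def)
  have val: "i < m \<and> f i = 2 * i \<and> rv i = 0 \<and> rd i = 0 \<and> rs i = 0
      \<or> i + 2 \<le> m \<and> f i = 2 * i + 4 \<and> rv i = 2 \<and> rd i = 1 \<and> rs i = 1
      \<or> m \<le> i \<and> i < 2 * m \<and> f i + 2 * m = 2 * i + 1 \<and> (rv i = 1 \<or> rv i = 3) \<and> (rs i = 2 \<or> rs i = 5)
      \<or> i = 2 * m \<and> f i = 2 \<and> rv i = 2 \<and> rs i = 4" if "i \<le> N" for i
  proof -
    consider k where "i = 2 * k" "i < m" | k where "i = 2 * k + 1" "i < m"
      | k where "i = m + k" "k < m" | "i = 2 * m"
    proof -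
      consider "i < m" "even i" | "i < m" "odd i" | "i = m + (i - m)" "i - m < m" | "i = 2 * m"
        using \<open>i \<le> N\<close> assms(3) by linarith
      then show thesis using that by cases (blast elim: evenE oddE)+
    qed
    then show ?thesis
    proof cases
      case (1 k)
      then have "f i = 4 * k + 0" "f i + i = 2 * (3 * k) + 0" "f i + i = 6 * k + 0" by (simp_all add: f_def)
      then have "rv i = 0" "rd i = 0" "rs i = 0" unfolding rv_def rs_def rd_def by - (erule residueI, simp)+
      then show ?thesis using 1 by (simp add: f_def)
    next
      case (2 k)
      then have "f i = 4 * (k + 1) + 2" "f i + i = 2 * (3 * k + 3) + 1" "f i + i = 6 * (k + 1) + 1"
        by (simp_all add: f_def)
      then have "rv i = 2" "rd i = 1" "rs i = 1" unfolding rv_def rs_def rd_def by - (erule residueI, simp)+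
      \<comment> \<open>\<open>m\<close> is odd here, so an odd position below it is at most \<open>m - 2\<close>.\<close>
      moreover have "i + 2 \<le> m" using 2 t by presburger
      ultimately show ?thesis using 2 by (simp add: f_def)
    next
      case (3 k)
      then have "f i = 2 * k + 1" "f i + i = 3 * (k + 2 * t) + 2" using t by (simp_all add: f_def)
      then have "(f i + i) mod 3 = 2" by - (erule residueI, simp)
      moreover have "x mod 3 = 2 \<Longrightarrow> x mod 6 = 2 \<or> x mod 6 = 5" for x :: nat by presburger
      ultimately have "rs i = 2 \<or> rs i = 5" unfolding rs_def by blast
      moreover have "rv i = 1 \<or> rv i = 3" unfolding rv_def \<open>f i = 2 * k + 1\<close> by presburger
      ultimately show ?thesis using 3 by (simp add: f_def)
    next
      case 4
      then have "f i = 2" "f i + i = 6 * (2 * t) + 4" using t by (simp_all add: f_def)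
      then have "rs i = 4" unfolding rs_def by - (erule residueI, simp)
      then show ?thesis using 4 \<open>f i = 2\<close> by (simp add: rv_def)
    qed
  qed
  let ?p = "\<lambda>e. if e then 0 else 4 :: nat" and ?q = "\<lambda>_::bool. 2::nat" and ?r = "\<lambda>_::bool. 4::nat"
  have "7 \<le> m" using assms(1) t by (cases t) auto
  show ?thesis
  proof (rule queen_solution_from_offsets)
    show "2 \<le> N" "m - 1 \<le> N - 1" "N - 1 \<le> N" using assms by auto
    show range: "1 \<le> f i \<and> f i \<le> N" if "1 \<le> i" "i \<le> N" for i
      using val[OF that(2)] that assms(1,3) by (elim disjE conjE; linarith)
    show "f i \<noteq> f j \<and> f i + j \<noteq> f j + i \<and> f i + i \<noteq> f j + j"
      if "1 \<le> i" "i < j" "j \<le> N" for i j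
    proof (intro conjI notI)
      assume eq: "f i = f j"
      then have "rv i = rv j" by (simp add: rv_def)
      then show False
        using val[of i, OF order.trans[OF less_imp_le[OF that(2)] that(3)]]
          val[of j, OF that(3)]
          eq that assms(1,3) by (elim disjE conjE; linarith)
    next
      assume eq: "f i + j = f j + i"
      then have "rd i = rd j" unfolding rd_def by (rule parity_of_diagonals)
      then show False
        using val[of i, OF order.trans[OF less_imp_le[OF that(2)] that(3)]]
          val[of j, OF that(3)]
          eq that assms(1,3) by (elim disjE conjE; linarith)
    next
      assume eq: "f i + i = f j + j"
      then have "rs i = rs j" by (simp add: rs_def)
      then show False
        using val[of i, OF order.trans[OF less_imp_le[OF that(2)] that(3)]]
          val[of j, OF that(3)]
          eq that assms(1,3) by (elim disjE conjE; linarith)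
    qed
    show "?p e \<le> N" "?q e \<le> N" "?r e \<le> N" for e using \<open>7 \<le> m\<close> assms by auto
    show "f i = (2 * i + ?p (even i)) mod (N + 1)" if "1 \<le> i" "i \<le> m - 1" for i
      using that range[of i] assms by (intro eq_modI[where c = 0]) (auto simp: f_def)
    show "f i = (2 * i + ?q (even i)) mod (N + 1)" if "m - 1 < i" "i \<le> N - 1" for i
      using that assms by (intro eq_modI[where c = 1]) (auto simp: f_def)
    show "f i = (2 * i + ?r (even i)) mod (N + 1)" if "N - 1 < i" "i \<le> N" for i
    proof -
      have "i = N" using that by simp
      then show ?thesis using assms by (intro eq_modI[where c = 2]) (simp_all add: f_def)
    qed
  qed
qed

section \<open>All boards\<close>

theorem mainTheorem1:
  fixes N :: nat
  assumes "N > 3"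
  shows "\<exists>A P. queens_solution N A \<and> queen_function N A P \<and> queen_width P \<le> 3"
proof -
  define m where "m = N div 2"
  have N: "N = 2 * m \<or> N = 2 * m + 1" and "2 \<le> m" using assms by (auto simp: m_def)
  consider "m mod 3 \<noteq> 1" | "m mod 3 = 1" "N = 2 * m + 1"
    | "m mod 6 = 4" "N = 2 * m" | "m mod 6 = 1" "N = 2 * m"
  proof -
    have "m mod 3 = 1 \<Longrightarrow> m mod 6 = 1 \<or> m mod 6 = 4" by presburger
    then show thesis using that N by blast
  qed
  then show ?thesis
  proof cases
    case 1 then show ?thesis using queens_even_then_odd \<open>2 \<le> m\<close> N by blast
  next
    case 2
    then have "4 \<le> m" using \<open>2 \<le> m\<close> by presburger
    then show ?thesis using queens_odd_multiple_of_three 2 by blast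
  next
    case 3 then show ?thesis using queens_eight_mod_twelve by blast
  next
    case 4 then show ?thesis using queens_two_mod_twelve \<open>2 \<le> m\<close> by blast
  qed
qed

end
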